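(* Let $(R,\mathfrak m)$ be an F-finite Noetherian local ring of prime characteristic $p>0$ and let $x\in\mathfrak m$ be a regular element on $R$. Assume that $R$ is compatibly F-pure along $(x)$. Then there exists an integer $N\gg0$ such that $R$ is compatibly F-pure along $(x+\delta)$ for all $\delta\in\mathfrak m^N$. In particular, $R/(x+\delta)$ is F-pure for each $\delta\in\mathfrak m^N$.
   Context: A ring of characteristic $p$ is F-finite if it is a finitely generated module over itself via Frobenius. A $p^{-e}$-linear map on $R$ is an additive map $\varphi\colon R\to R$ with $\varphi(r^{p^e}s)=r\varphi(s)$ for all $r,s\in R$; a Cartier map is a $p^{-e}$-linear map for some integer $e\geq1$. $R$ is F-pure if there is a $p^{-1}$-linear map $\varphi$ with $\varphi\circ F=\mathrm{id}_R$, where $F$ is Frobenius. For an ideal $\mathfrak a\subseteq\mathfrak m$, $R$ is compatibly F-pure along $\mathfrak a$ if there is a Cartier map $\varphi\colon R\to R$ with $\varphi(1)=1$ and $\varphi(\mathfrak a)\subseteq\mathfrak a$ (equivalently, $R$ is F-pure and there is a splitting of Frobenius that descends to $R/\mathfrak a$). *)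

theory Defs
  imports "HOL-Algebra.Algebra"
begin

text \<open>The characteristic of a ring is the additive order of \<open>\<one>\<close>; \<^const>\<open>group.ord\<close> is \<open>0\<close> on
  elements of infinite order. \<open>Factorial_Ring.prime\<close> is primality of numbers, as opposed to
  \<^const>\<open>Divisibility.prime\<close>.\<close>

definition ring_char :: "('a, 'b) ring_scheme \<Rightarrow> nat" where
  "ring_char R = group.ord (add_monoid R) \<one>\<^bsub>R\<^esub>"

definition prime_char_ring :: "nat \<Rightarrow> ('a, 'b) ring_scheme \<Rightarrow> bool" where
  "prime_char_ring p R \<longleftrightarrow> cring R \<and> Factorial_Ring.prime p \<and> ring_char R = p"

definition noetherian_local_ring :: "('a, 'b) ring_scheme \<Rightarrow> 'a set \<Rightarrow> bool" where
  "noetherian_local_ring R \<mm> \<longleftrightarrow>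
     cring R \<and> noetherian_ring R \<and> maximalideal \<mm> R \<and> (\<forall>I. maximalideal I R \<longrightarrow> I = \<mm>)"

definition regular_element :: "('a, 'b) ring_scheme \<Rightarrow> 'a \<Rightarrow> bool" where
  "regular_element R x \<longleftrightarrow>
     x \<in> carrier R \<and> (\<forall>y\<in>carrier R. x \<otimes>\<^bsub>R\<^esub> y = \<zero>\<^bsub>R\<^esub> \<longrightarrow> y = \<zero>\<^bsub>R\<^esub>)"

definition finitely_generated_module ::
    "('a, 'b) ring_scheme \<Rightarrow> ('a, 'c, 'd) module_scheme \<Rightarrow> bool" where
  "finitely_generated_module R M \<longleftrightarrow>
     (\<exists>S\<subseteq>carrier M. finite S \<and>
        (\<forall>v\<in>carrier M. \<exists>c\<in>S \<rightarrow> carrier R. v = (\<Oplus>\<^bsub>M\<^esub>s\<in>S. c s \<odot>\<^bsub>M\<^esub> s)))"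

definition frobenius :: "nat \<Rightarrow> ('a, 'b) ring_scheme \<Rightarrow> 'a \<Rightarrow> 'a" where
  "frobenius p R r = r [^]\<^bsub>R\<^esub> p"

text \<open>\<open>R\<close> as a module over itself by restriction of scalars along Frobenius.\<close>

definition frobenius_module :: "nat \<Rightarrow> ('a, 'b) ring_scheme \<Rightarrow> ('a, 'a) module" where
  "frobenius_module p R =
     \<lparr> carrier = carrier R, monoid.mult = monoid.mult R, one = one R, ring.zero = ring.zero R, ring.add = ring.add R,
       smult = (\<lambda>r s. frobenius p R r \<otimes>\<^bsub>R\<^esub> s) \<rparr>"

definition F_finite :: "nat \<Rightarrow> ('a, 'b) ring_scheme \<Rightarrow> bool" where
  "F_finite p R \<longleftrightarrow> prime_char_ring p R \<and> finitely_generated_module R (frobenius_module p R)"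

definition p_inv_linear :: "nat \<Rightarrow> nat \<Rightarrow> ('a, 'b) ring_scheme \<Rightarrow> ('a \<Rightarrow> 'a) \<Rightarrow> bool" where
  "p_inv_linear p e R \<phi> \<longleftrightarrow>
     \<phi> \<in> hom (add_monoid R) (add_monoid R) \<and>
     (\<forall>r\<in>carrier R. \<forall>s\<in>carrier R. \<phi> (r [^]\<^bsub>R\<^esub> (p ^ e) \<otimes>\<^bsub>R\<^esub> s) = r \<otimes>\<^bsub>R\<^esub> \<phi> s)"

definition cartier_map :: "nat \<Rightarrow> ('a, 'b) ring_scheme \<Rightarrow> ('a \<Rightarrow> 'a) \<Rightarrow> bool" where
  "cartier_map p R \<phi> \<longleftrightarrow> (\<exists>e\<ge>1. p_inv_linear p e R \<phi>)"

definition F_pure :: "nat \<Rightarrow> ('a, 'b) ring_scheme \<Rightarrow> bool" where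
  "F_pure p R \<longleftrightarrow> prime_char_ring p R \<and>
     (\<exists>\<phi>. p_inv_linear p 1 R \<phi> \<and> (\<forall>r\<in>carrier R. \<phi> (frobenius p R r) = r))"

definition compatibly_F_pure_along ::
    "nat \<Rightarrow> ('a, 'b) ring_scheme \<Rightarrow> 'a set \<Rightarrow> 'a set \<Rightarrow> bool" where
  "compatibly_F_pure_along p R \<mm> \<aa> \<longleftrightarrow>
     prime_char_ring p R \<and> ideal \<aa> R \<and> \<aa> \<subseteq> \<mm> \<and>
     (\<exists>\<phi>. cartier_map p R \<phi> \<and> \<phi> \<one>\<^bsub>R\<^esub> = \<one>\<^bsub>R\<^esub> \<and> \<phi> ` \<aa> \<subseteq> \<aa>)"

text \<open>Powers of ideals are taken in the library's monoid \<^const>\<open>ideals_set\<close> of ideals under the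
  ideal product, so the zeroth power is the whole ring.\<close>

abbreviation ideal_power :: "('a, 'b) ring_scheme \<Rightarrow> 'a set \<Rightarrow> nat \<Rightarrow> 'a set" where
  "ideal_power R I n \<equiv> I [^]\<^bsub>ideals_set R\<^esub> n"

end

theory Submission
  imports Defs
begin

text \<open>
  Write \<open>q = p ^ e\<close> and let \<open>\<phi>\<close> be a \<open>p ^ (-e)\<close>-linear map with \<open>\<phi> \<one> = \<one>\<close> that preserves
  \<open>(x)\<close>. Since \<open>x\<close> is regular, \<open>\<phi> (x r) = x \<psi> r\<close> defines another \<open>p ^ (-e)\<close>-linear map \<open>\<psi>\<close>, and
  cancelling \<open>x\<close> from \<open>x \<phi> r = \<phi> (x ^ q r) = x \<psi> (x ^ (q - 1) r)\<close> shows that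
  \<open>\<phi> = \<psi> (x ^ (q - 1) \<cdot>)\<close> (\<open>p_inv_linear_divide_regular\<close>). So compatibility with \<open>x\<close> has been
  traded for the single equation \<open>\<psi> (x ^ (q - 1)) = \<one>\<close>, and this equation can be perturbed.
  For every \<open>y \<in> \<mm>\<close>, the map \<open>r \<mapsto> \<psi> (y ^ (q - 1) r)\<close> preserves \<open>(y)\<close>, because it sends
  \<open>y r\<close> to \<open>\<psi> (y ^ q r) = y \<psi> r\<close>; it can be rescaled to send \<open>\<one>\<close> to \<open>\<one>\<close> as soon as
  \<open>\<psi> (y ^ (q - 1))\<close> is a unit (\<open>compatibly_F_pure_alongI\<close>).

  Now let \<open>y = x + \<delta>\<close> with \<open>\<delta> \<in> \<mm> ^ N\<close>. Then \<open>y ^ (q - 1)\<close> and \<open>x ^ (q - 1)\<close> differ by an element of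
  \<open>\<mm> ^ N\<close>, so if \<open>\<psi>\<close> maps \<open>\<mm> ^ N\<close> into \<open>\<mm>\<close>, then \<open>\<psi> (y ^ (q - 1))\<close> is congruent to \<open>\<one>\<close> modulo \<open>\<mm>\<close>
  and hence a unit of the local ring \<open>R\<close>. This inclusion holds for large \<open>N\<close>:
  \<open>\<psi>\<close> maps the ideal generated by the \<open>q\<close>-th powers of elements of \<open>\<mm>\<close> into \<open>\<mm>\<close>, and by the
  pigeonhole principle this ideal contains a power of the finitely generated ideal \<open>\<mm>\<close>
  (\<open>p_inv_linear_ideal_power_subset\<close>).

  Finally, a Cartier map that fixes \<open>\<one>\<close> and preserves \<open>(y)\<close> induces one on \<open>R / (y)\<close> that fixes
  \<open>\<one>\<close>. Its exponent \<open>e\<close> may exceed \<open>1\<close>, whereas F-purity asks for a \<open>p ^ (-1)\<close>-linear map; composing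
  with \<open>e - 1\<close> Frobenius maps repairs this, which is where additivity of the Frobenius enters.
\<close>

section \<open>The Frobenius is additive in prime characteristic\<close>

lemma (in cring) binomial_expansion:
  assumes a: "a \<in> carrier R" and b: "b \<in> carrier R"
  shows "(a \<oplus> b) [^] n = (\<Oplus>k\<in>{..n}. [(n choose k)] \<cdot> (a [^] k \<otimes> b [^] (n - k)))"
proof (induction n)
  case 0
  then show ?case by simp
next
  case (Suc n)
  let ?t = "\<lambda>n k. [(n choose k)] \<cdot> (a [^] k \<otimes> b [^] (n - k))"
  have t_closed: "?t n k \<in> carrier R" for n k
    using a b by simp
  have times_a: "(\<Oplus>k\<in>{..n}. ?t n k) \<otimes> a = (\<Oplus>k\<in>{..n}. [(n choose k)] \<cdot> (a [^] Suc k \<otimes> b [^] (n - k)))"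
  proof -
    have "(\<Oplus>k\<in>{..n}. ?t n k) \<otimes> a = (\<Oplus>k\<in>{..n}. ?t n k \<otimes> a)"
      using a b by (intro finsum_ldistr) auto
    also have "\<dots> = (\<Oplus>k\<in>{..n}. [(n choose k)] \<cdot> (a [^] Suc k \<otimes> b [^] (n - k)))"
      using a b by (intro finsum_cong') (auto simp: add_pow_ldistr add_pow_rdistr m_ac)
    finally show ?thesis .
  qed
  have times_b: "(\<Oplus>k\<in>{..n}. ?t n k) \<otimes> b =
      (\<Oplus>k\<in>{..n}. [(n choose Suc k)] \<cdot> (a [^] Suc k \<otimes> b [^] (n - k))) \<oplus> b [^] Suc n"
  proof -
    let ?s = "\<lambda>k. [(n choose k)] \<cdot> (a [^] k \<otimes> b [^] (Suc n - k))"
    have s_closed: "?s k \<in> carrier R" for k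
      using a b by simp
    have "(\<Oplus>k\<in>{..n}. ?t n k) \<otimes> b = (\<Oplus>k\<in>{..n}. ?t n k \<otimes> b)"
      using a b by (intro finsum_ldistr) auto
    also have "\<dots> = (\<Oplus>k\<in>{..n}. ?s k)"
      using a b by (intro finsum_cong') (auto simp: add_pow_ldistr add_pow_rdistr Suc_diff_le m_ac)
    also have "\<dots> = (\<Oplus>k\<in>{..Suc n}. ?s k)"
    proof -
      have "finsum R ?s {..n} \<in> carrier R"
        using s_closed by (intro finsum_closed) auto
      then show ?thesis
        using finsum_Suc[of ?s n] s_closed a by (simp add: Pi_def binomial_eq_0)
    qed
    also have "\<dots> = (\<Oplus>k\<in>{..n}. ?s (Suc k)) \<oplus> ?s 0"
      using s_closed by (intro finsum_Suc2) auto
    finally show ?thesis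
      using b by simp
  qed
  have "(a \<oplus> b) [^] Suc n = (\<Oplus>k\<in>{..n}. ?t n k) \<otimes> a \<oplus> (\<Oplus>k\<in>{..n}. ?t n k) \<otimes> b"
    using Suc.IH a b t_closed by (simp add: r_distr finsum_closed Pi_def)
  also have "\<dots> = ((\<Oplus>k\<in>{..n}. [(n choose k)] \<cdot> (a [^] Suc k \<otimes> b [^] (n - k))) \<oplus>
      (\<Oplus>k\<in>{..n}. [(n choose Suc k)] \<cdot> (a [^] Suc k \<otimes> b [^] (n - k)))) \<oplus> b [^] Suc n"
    unfolding times_a times_b using a b by (intro a_assoc[symmetric] finsum_closed) auto
  also have "\<dots> = (\<Oplus>k\<in>{..n}. ?t (Suc n) (Suc k)) \<oplus> ?t (Suc n) 0"
    using a b by (simp add: finsum_addf[symmetric] add.nat_pow_mult Pi_def)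
  also have "\<dots> = (\<Oplus>k\<in>{..Suc n}. ?t (Suc n) k)"
    using t_closed by (intro finsum_Suc2[symmetric]) auto
  finally show ?case .
qed

lemma (in ring) ring_char_dvd_iff: "ring_char R dvd n \<longleftrightarrow> [n] \<cdot> \<one> = \<zero>" for n :: nat
  using add.pow_eq_id[of \<one> n] by (simp add: ring_char_def)

lemma (in cring) add_pow_multiple_of_char:
  assumes "ring_char R dvd n" and a: "a \<in> carrier R"
  shows "[n] \<cdot> a = \<zero>"
proof -
  have "[n] \<cdot> a = ([n] \<cdot> \<one>) \<otimes> a"
    using a by (simp add: add_pow_ldistr)
  then show ?thesis
    using assms by (simp add: ring_char_dvd_iff)
qed

lemma frobenius_add:
  fixes R :: "('a, 'b) ring_scheme" (structure)
  assumes R: "prime_char_ring p R" and a: "a \<in> carrier R" and b: "b \<in> carrier R"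
  shows "(a \<oplus> b) [^] p = a [^] p \<oplus> b [^] p"
proof -
  interpret cring R
    using R by (simp add: prime_char_ring_def)
  have p: "Factorial_Ring.prime p" and char: "ring_char R = p"
    using R by (auto simp: prime_char_ring_def)
  obtain l where l: "p = Suc (Suc l)"
    using prime_ge_2_nat[OF p] by (metis add_2_eq_Suc le_Suc_ex)
  let ?t = "\<lambda>k. [(p choose k)] \<cdot> (a [^] k \<otimes> b [^] (p - k))"
  have t_closed: "?t \<in> A \<rightarrow> carrier R" for A
    using a b by auto
  have middle: "?t (Suc k) = \<zero>" if "k \<in> {..l}" for k
  proof -
    have "p dvd (p choose Suc k)"
      using that p l by (intro dvd_choose_prime) auto
    then show ?thesis
      using a b char by (intro add_pow_multiple_of_char) auto
  qed
  have "(a \<oplus> b) [^] p = (\<Oplus>k\<in>{..p}. ?t k)"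
    by (rule binomial_expansion[OF a b])
  also have "\<dots> = ?t p \<oplus> (\<Oplus>k\<in>{..Suc l}. ?t k)"
    using finsum_Suc[OF t_closed, of "Suc l"] l by simp
  also have "(\<Oplus>k\<in>{..Suc l}. ?t k) = (\<Oplus>k\<in>{..l}. ?t (Suc k)) \<oplus> ?t 0"
    by (rule finsum_Suc2[OF t_closed])
  also have "(\<Oplus>k\<in>{..l}. ?t (Suc k)) = \<zero>"
    using middle by (intro add.finprod_one_eqI)
  finally show ?thesis
    using a b by simp
qed

lemma frobenius_iterate_add:
  fixes R :: "('a, 'b) ring_scheme" (structure)
  assumes R: "prime_char_ring p R" and a: "a \<in> carrier R" and b: "b \<in> carrier R"
  shows "(a \<oplus> b) [^] (p ^ e) = a [^] (p ^ e) \<oplus> b [^] (p ^ e)"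
proof -
  interpret cring R
    using R by (simp add: prime_char_ring_def)
  have iterate: "c [^] (p ^ Suc e) = (c [^] (p ^ e)) [^] p" if "c \<in> carrier R" for c e
    using that by (simp add: nat_pow_pow mult.commute)
  show ?thesis
  proof (induction e)
    case 0
    show ?case
      using a b by simp
  next
    case (Suc e)
    then show ?case
      using a b frobenius_add[OF R, of "a [^] (p ^ e)" "b [^] (p ^ e)"] by (simp only: iterate a_closed nat_pow_closed)
  qed
qed


section \<open>Cartier maps on a quotient\<close>

lemma p_inv_linearD:
  fixes R :: "('a, 'b) ring_scheme" (structure)
  assumes "p_inv_linear p e R \<phi>"
  shows p_inv_linear_closed: "r \<in> carrier R \<Longrightarrow> \<phi> r \<in> carrier R"
    and p_inv_linear_add: "r \<in> carrier R \<Longrightarrow> s \<in> carrier R \<Longrightarrow> \<phi> (r \<oplus> s) = \<phi> r \<oplus> \<phi> s"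
    and p_inv_linear_smult:
      "r \<in> carrier R \<Longrightarrow> s \<in> carrier R \<Longrightarrow> \<phi> (r [^] (p ^ e) \<otimes> s) = r \<otimes> \<phi> s"
  using assms by (auto simp: p_inv_linear_def hom_def Pi_def)

lemma p_inv_linearI:
  fixes R :: "('a, 'b) ring_scheme" (structure)
  assumes "\<And>r. r \<in> carrier R \<Longrightarrow> \<phi> r \<in> carrier R"
    and "\<And>r s. r \<in> carrier R \<Longrightarrow> s \<in> carrier R \<Longrightarrow> \<phi> (r \<oplus> s) = \<phi> r \<oplus> \<phi> s"
    and "\<And>r s. r \<in> carrier R \<Longrightarrow> s \<in> carrier R \<Longrightarrow> \<phi> (r [^] (p ^ e) \<otimes> s) = r \<otimes> \<phi> s"
  shows "p_inv_linear p e R \<phi>"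
  using assms by (auto simp: p_inv_linear_def hom_def)

text \<open>Each Frobenius map that is applied before \<open>\<phi>\<close> lowers the exponent of linearity by one, and it
  leaves the value at \<open>\<one>\<close> alone.\<close>

lemma p_inv_linear_comp_frobenius:
  fixes R :: "('a, 'b) ring_scheme" (structure)
  assumes R: "prime_char_ring p R" and \<phi>: "p_inv_linear p (Suc e) R \<phi>"
  shows "p_inv_linear p 1 R (\<lambda>r. \<phi> (r [^] (p ^ e)))"
proof -
  interpret cring R
    using R by (simp add: prime_char_ring_def)
  show ?thesis
  proof (rule p_inv_linearI)
    fix r s assume r: "r \<in> carrier R" and s: "s \<in> carrier R"
    show "\<phi> ((r \<oplus> s) [^] (p ^ e)) = \<phi> (r [^] (p ^ e)) \<oplus> \<phi> (s [^] (p ^ e))"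
      using r s by (simp add: frobenius_iterate_add[OF R] p_inv_linear_add[OF \<phi>])
    have "(r [^] (p ^ 1) \<otimes> s) [^] (p ^ e) = r [^] (p ^ Suc e) \<otimes> s [^] (p ^ e)"
      using r s by (simp add: nat_pow_distrib nat_pow_pow)
    then show "\<phi> ((r [^] (p ^ 1) \<otimes> s) [^] (p ^ e)) = r \<otimes> \<phi> (s [^] (p ^ e))"
      using r s p_inv_linear_smult[OF \<phi>, of r "s [^] (p ^ e)"] by simp
  qed (auto intro: p_inv_linear_closed[OF \<phi>])
qed

lemma prime_char_ring_quotient:
  fixes R :: "('a, 'b) ring_scheme" (structure)
  assumes R: "prime_char_ring p R" and I: "ideal I R" and proper: "I \<noteq> carrier R"
  shows "prime_char_ring p (R Quot I)"
proof -
  interpret cring R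
    using R by (simp add: prime_char_ring_def)
  interpret I: ideal I R by (fact I)
  interpret Q: cring "R Quot I"
    by (rule I.quotient_is_cring[OF is_cring])
  interpret h: ring_hom_cring R "R Quot I" "(+>) I"
    by (rule I.rcos_ring_hom_cring[OF is_cring])
  have p: "Factorial_Ring.prime p" and char: "ring_char R = p"
    using R by (auto simp: prime_char_ring_def)
  have "[p] \<cdot>\<^bsub>R Quot I\<^esub> \<one>\<^bsub>R Quot I\<^esub> = I +> ([p] \<cdot> \<one>)"
  proof -
    have "I +> ([n] \<cdot> \<one>) = [n] \<cdot>\<^bsub>R Quot I\<^esub> \<one>\<^bsub>R Quot I\<^esub>" for n :: nat
      by (induction n) simp_all
    then show ?thesis by simp
  qed
  also have "\<dots> = \<zero>\<^bsub>R Quot I\<^esub>"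
    using ring_char_dvd_iff[of p] char by simp
  finally have "ring_char (R Quot I) dvd p"
    by (simp add: Q.ring_char_dvd_iff)
  moreover have "ring_char (R Quot I) \<noteq> 1"
  proof
    assume "ring_char (R Quot I) = 1"
    then have "[(1::nat)] \<cdot>\<^bsub>R Quot I\<^esub> \<one>\<^bsub>R Quot I\<^esub> = \<zero>\<^bsub>R Quot I\<^esub>"
      by (intro iffD1[OF Q.ring_char_dvd_iff]) simp
    then have "\<one>\<^bsub>R Quot I\<^esub> = \<zero>\<^bsub>R Quot I\<^esub>"
      by simp
    then have "I +> \<one> = I"
      unfolding FactRing_def by simp
    then show False
      using I.rcos_const_imp_mem[of \<one>] I.one_imp_carrier proper by simp
  qed
  ultimately show ?thesis
    using p Q.is_cring by (auto simp: prime_char_ring_def prime_nat_iff)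
qed

lemma p_inv_linear_quotient:
  fixes R :: "('a, 'b) ring_scheme" (structure)
  assumes R: "cring R" and I: "ideal I R" and \<phi>: "p_inv_linear p e R \<phi>" and "\<phi> ` I \<subseteq> I"
  obtains \<psi> where "p_inv_linear p e (R Quot I) \<psi>"
    and "\<And>r. r \<in> carrier R \<Longrightarrow> \<psi> (I +> r) = I +> \<phi> r"
proof -
  interpret cring R by (fact R)
  interpret I: ideal I R by (fact I)
  interpret h: ring_hom_cring R "R Quot I" "(+>) I"
    by (rule I.rcos_ring_hom_cring[OF is_cring])
  have coset: "\<exists>r\<in>carrier R. c = I +> r" if "c \<in> carrier (R Quot I)" for c
    using that unfolding FactRing_def A_RCOSETS_def' by simp
  \<comment> \<open>Two representatives of a coset differ by an element of \<open>I\<close>, which \<open>\<phi>\<close> keeps in \<open>I\<close>, so the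
    choice of representative is immaterial.\<close>
  define \<psi> where "\<psi> c = I +> \<phi> (SOME r. r \<in> carrier R \<and> c = I +> r)" for c
  have \<psi>: "\<psi> (I +> r) = I +> \<phi> r" if r: "r \<in> carrier R" for r
  proof -
    define s where "s = (SOME s. s \<in> carrier R \<and> I +> r = I +> s)"
    have s: "s \<in> carrier R" "I +> r = I +> s"
      unfolding s_def using someI[of "\<lambda>s. s \<in> carrier R \<and> I +> r = I +> s" r] r by auto
    have "s \<ominus> r \<in> I"
      using quotient_eq_iff_same_a_r_cos[OF I] r s by simp
    then have "\<phi> (s \<ominus> r) \<in> I"
      using assms(4) by auto
    moreover have "\<phi> s = \<phi> (s \<ominus> r) \<oplus> \<phi> r"
    proof -
      have "(s \<ominus> r) \<oplus> r = s"
        using r s(1) by (simp add: a_minus_def a_assoc l_neg)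
      then show ?thesis
        using p_inv_linear_add[OF \<phi>, of "s \<ominus> r" r] r s(1) by simp
    qed
    ultimately have "\<phi> s \<ominus> \<phi> r \<in> I"
      using p_inv_linear_closed[OF \<phi>] r s(1)
      by (simp add: a_minus_def a_assoc r_neg)
    then have "I +> \<phi> s = I +> \<phi> r"
      using quotient_eq_iff_same_a_r_cos[OF I] p_inv_linear_closed[OF \<phi>] r s(1) by blast
    then show ?thesis
      by (simp add: \<psi>_def s_def)
  qed
  have "p_inv_linear p e (R Quot I) \<psi>"
  proof (rule p_inv_linearI)
    fix c d assume "c \<in> carrier (R Quot I)" "d \<in> carrier (R Quot I)"
    then obtain r s where rs: "r \<in> carrier R" "c = I +> r" "s \<in> carrier R" "d = I +> s"
      using coset by metis
    show "\<psi> c \<in> carrier (R Quot I)"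
      using rs p_inv_linear_closed[OF \<phi>] by (simp add: \<psi>)
    have "\<psi> (I +> (r \<oplus> s)) = I +> (\<phi> r \<oplus> \<phi> s)"
      using rs by (subst \<psi>) (auto simp: p_inv_linear_add[OF \<phi>])
    then show "\<psi> (c \<oplus>\<^bsub>R Quot I\<^esub> d) = \<psi> c \<oplus>\<^bsub>R Quot I\<^esub> \<psi> d"
      using rs p_inv_linear_closed[OF \<phi>] by (simp add: \<psi>)
    have "\<psi> (I +> (r [^] (p ^ e) \<otimes> s)) = I +> (r \<otimes> \<phi> s)"
      using rs by (subst \<psi>) (auto simp: p_inv_linear_smult[OF \<phi>])
    then show "\<psi> (c [^]\<^bsub>R Quot I\<^esub> (p ^ e) \<otimes>\<^bsub>R Quot I\<^esub> d) = c \<otimes>\<^bsub>R Quot I\<^esub> \<psi> d"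
      using rs p_inv_linear_closed[OF \<phi>] by (simp add: \<psi>)
  qed
  then show thesis
    using \<psi> that by blast
qed

lemma compatibly_F_pure_imp_F_pure_quotient:
  fixes R :: "('a, 'b) ring_scheme" (structure)
  assumes R: "compatibly_F_pure_along p R \<mm> I" and proper: "I \<noteq> carrier R"
  shows "F_pure p (R Quot I)"
proof -
  have char: "prime_char_ring p R" and I: "ideal I R"
    using R by (auto simp: compatibly_F_pure_along_def)
  obtain e \<phi> where "e \<ge> 1" and \<phi>: "p_inv_linear p e R \<phi>" "\<phi> \<one> = \<one>" "\<phi> ` I \<subseteq> I"
    using R by (auto simp: compatibly_F_pure_along_def cartier_map_def)
  then obtain d where "e = Suc d"
    by (metis One_nat_def Suc_le_D)
  note \<phi> = \<phi>[unfolded this]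
  interpret cring R
    using char by (simp add: prime_char_ring_def)
  interpret I: ideal I R by (fact I)
  interpret Q: cring "R Quot I"
    by (rule I.quotient_is_cring[OF is_cring])
  interpret h: ring_hom_cring R "R Quot I" "(+>) I"
    by (rule I.rcos_ring_hom_cring[OF is_cring])
  have char_Q: "prime_char_ring p (R Quot I)"
    by (rule prime_char_ring_quotient[OF char I proper])
  obtain \<psi> where \<psi>: "p_inv_linear p (Suc d) (R Quot I) \<psi>"
    and \<psi>_coset: "\<And>r. r \<in> carrier R \<Longrightarrow> \<psi> (I +> r) = I +> \<phi> r"
    using p_inv_linear_quotient[OF is_cring I \<phi>(1,3)] by blast
  have \<psi>_one: "\<psi> \<one>\<^bsub>R Quot I\<^esub> = \<one>\<^bsub>R Quot I\<^esub>"
    using \<psi>_coset[of \<one>] \<phi>(2) by simp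
  let ?\<psi> = "\<lambda>c. \<psi> (c [^]\<^bsub>R Quot I\<^esub> (p ^ d))"
  have "?\<psi> (frobenius p (R Quot I) c) = c" if "c \<in> carrier (R Quot I)" for c
  proof -
    have "?\<psi> (frobenius p (R Quot I) c) = \<psi> (c [^]\<^bsub>R Quot I\<^esub> (p ^ Suc d) \<otimes>\<^bsub>R Quot I\<^esub> \<one>\<^bsub>R Quot I\<^esub>)"
      using that by (simp add: frobenius_def Q.nat_pow_pow)
    also have "\<dots> = c"
      using p_inv_linear_smult[OF \<psi> that Q.one_closed] \<psi>_one that by simp
    finally show ?thesis .
  qed
  then show ?thesis
    using char_Q p_inv_linear_comp_frobenius[OF char_Q \<psi>] unfolding F_pure_def by blast
qed


section \<open>Noetherian local rings\<close>

text \<open>Zorn's lemma, in a case where upper bounds of chains come for free: in a Noetherian ring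
  every nonempty chain of ideals contains its union.\<close>

lemma (in noetherian_ring) proper_ideal_subset_maximalideal:
  assumes I: "ideal I R" and proper: "I \<noteq> carrier R"
  obtains M where "maximalideal M R" and "I \<subseteq> M"
proof -
  let ?A = "{J. ideal J R \<and> I \<subseteq> J \<and> J \<noteq> carrier R}"
  have "\<exists>M\<in>?A. \<forall>J\<in>?A. M \<subseteq> J \<longrightarrow> J = M"
  proof (rule subset_Zorn)
    fix C assume C: "subset.chain ?A C"
    show "\<exists>U\<in>?A. \<forall>J\<in>C. J \<subseteq> U"
    proof (cases "C = {}")
      case True
      then show ?thesis
        using assms by blast
    next
      case False
      have "subset.chain {J. ideal J R} C"
        using C unfolding pred_on.chain_def by blast
      then have "\<Union>C \<in> C"
        by (rule ideal_chain_is_trivial[OF False])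
      moreover have "C \<subseteq> ?A"
        using C unfolding pred_on.chain_def by blast
      ultimately show ?thesis
        by (meson Union_upper subsetD)
    qed
  qed
  then obtain M where "M \<in> ?A" and max: "\<forall>J\<in>?A. M \<subseteq> J \<longrightarrow> J = M" ..
  then have M: "ideal M R" "I \<subseteq> M" "M \<noteq> carrier R"
    by simp_all
  have "maximalideal M R"
  proof (rule maximalidealI[OF M(1)])
    show "carrier R \<noteq> M"
      using M(3) by blast
    show "J = M \<or> J = carrier R" if "ideal J R" "M \<subseteq> J" for J
      using max M(2) that by blast
  qed
  then show thesis
    using M(2) that by blast
qed

lemma noetherian_local_ring_unit:
  fixes R :: "('a, 'b) ring_scheme" (structure)
  assumes R: "noetherian_local_ring R \<mm>" and u: "u \<in> carrier R" "u \<notin> \<mm>"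
  obtains v where "v \<in> carrier R" and "v \<otimes> u = \<one>"
proof -
  interpret cring R
    using R by (simp add: noetherian_local_ring_def)
  interpret noetherian_ring R
    using R by (simp add: noetherian_local_ring_def)
  have "PIdl u = carrier R"
  proof (rule ccontr)
    assume "PIdl u \<noteq> carrier R"
    then obtain M where "maximalideal M R" "PIdl u \<subseteq> M"
      using proper_ideal_subset_maximalideal[OF cgenideal_ideal[OF u(1)]] by blast
    then show False
      using R u cgenideal_self[OF u(1)] by (auto simp: noetherian_local_ring_def)
  qed
  then have "\<one> \<in> PIdl u"
    by simp
  then show thesis
    using that unfolding cgenideal_def by auto
qed


section \<open>Powers of ideals\<close>

lemma ideal_power_0: "ideal_power R I 0 = carrier R"
  by (simp add: nat_pow_def ideals_set_def)

lemma ideal_power_Suc: "ideal_power R I (Suc n) = ideal_prod R (ideal_power R I n) I"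
  by (simp add: nat_pow_def ideals_set_def)

lemma (in ring) ideal_power_is_ideal:
  assumes "ideal I R"
  shows "ideal (ideal_power R I n) R"
  by (induction n) (simp_all only: ideal_power_0 ideal_power_Suc oneideal ideal_prod_is_ideal assms)

text \<open>The pigeonhole principle for ideal powers. Read on monomials, a product of more than
  \<open>\<Sum>s\<in>S. n s\<close> generators contains some generator \<open>s\<close> at least \<open>n s\<close> times, so it lies in \<open>J\<close>. The proof
  avoids monomials by splitting off one generator \<open>s\<close> at a time: this lowers \<open>n s\<close> by one and
  replaces \<open>J\<close> by the colon ideal \<open>J : s\<close>. This is why the exponents are allowed to differ
  between generators, even for an application where they all agree.\<close>

lemma (in cring) ideal_power_genideal_subset:
  assumes S: "finite S" "S \<subseteq> carrier R" and "ideal J R"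
    and "\<And>s. s \<in> S \<Longrightarrow> s [^] n s \<in> J"
  shows "ideal_power R (Idl S) (Suc (\<Sum>s\<in>S. n s)) \<subseteq> J"
  using assms(3,4)
proof (induction "\<Sum>s\<in>S. n s" arbitrary: n J rule: less_induct)
  case less
  interpret J: ideal J R by (fact less.prems)
  have power_ideal: "ideal (ideal_power R (Idl S) k) R" for k
    by (rule ideal_power_is_ideal[OF genideal_ideal[OF S(2)]])
  have generator: "s \<otimes> z \<in> J" if z: "z \<in> ideal_power R (Idl S) (\<Sum>s\<in>S. n s)" and s: "s \<in> S" for s z
  proof (cases "n s")
    case 0
    then have "J = carrier R"
      using less.prems(2)[OF s] J.one_imp_carrier by simp
    then show ?thesis
      using s S(2) z ideal.Icarr[OF power_ideal] by blast
  next
    case (Suc k)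
    \<comment> \<open>The exponents and the colon ideal to which the induction hypothesis is applied\<close>
    let ?n = "n(s := k)"
    let ?J = "{y \<in> carrier R. s \<otimes> y \<in> J}"
    have sum_n: "(\<Sum>t\<in>S. n t) = Suc (\<Sum>t\<in>S. ?n t)"
    proof -
      have "(\<Sum>t\<in>S - {s}. ?n t) = (\<Sum>t\<in>S - {s}. n t)"
        by (intro sum.cong) auto
      then show ?thesis
        using S(1) s Suc by (simp add: sum.remove)
    qed
    have s_carr: "s \<in> carrier R"
      using s S(2) by blast
    have "ideal ?J R"
      by (rule J.helper_max_prime[OF is_cring s_carr])
    moreover have "t [^] ?n t \<in> ?J" if "t \<in> S" for t
    proof (cases "t = s")
      case True
      have "s \<otimes> s [^] k = s [^] n s"
        using s_carr Suc by (simp add: m_comm)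
      then show ?thesis
        using True less.prems(2)[OF s] s_carr by simp
    next
      case False
      then show ?thesis
        using less.prems(2)[OF that] s_carr J.I_l_closed that S(2) by auto
    qed
    ultimately have "ideal_power R (Idl S) (Suc (\<Sum>t\<in>S. ?n t)) \<subseteq> ?J"
      using sum_n by (intro less.hyps) auto
    then show ?thesis
      using z sum_n by auto
  qed
  have product: "z \<otimes> y \<in> J" if z: "z \<in> ideal_power R (Idl S) (\<Sum>s\<in>S. n s)" and y: "y \<in> Idl S" for y z
  proof -
    have z_carr: "z \<in> carrier R"
      using z ideal.Icarr[OF power_ideal] by blast
    have "Idl S \<subseteq> {y \<in> carrier R. z \<otimes> y \<in> J}"
      using generator[OF z] S(2) z_carr
      by (intro genideal_minimal J.helper_max_prime[OF is_cring]) (auto simp: m_comm)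
    then show ?thesis
      using y by blast
  qed
  show ?case
  proof
    fix r assume "r \<in> ideal_power R (Idl S) (Suc (\<Sum>s\<in>S. n s))"
    then have "r \<in> ideal_prod R (ideal_power R (Idl S) (\<Sum>s\<in>S. n s)) (Idl S)"
      by (simp only: ideal_power_Suc)
    then show "r \<in> J"
      by (induction rule: ideal_prod.induct) (auto intro: product)
  qed
qed

lemma (in cring) pow_congruent:
  assumes I: "ideal I R" and a: "a \<in> carrier R" and d: "d \<in> I"
  shows "\<exists>c\<in>I. (a \<oplus> d) [^] (n :: nat) = a [^] n \<oplus> c"
proof -
  interpret I: ideal I R by (fact I)
  interpret h: ring_hom_cring R "R Quot I" "(+>) I"
    by (rule I.rcos_ring_hom_cring[OF is_cring])
  have d': "d \<in> carrier R"
    using d by (rule I.Icarr)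
  have ad: "(a \<oplus> d) \<ominus> a \<in> I"
  proof -
    have "(a \<oplus> d) \<ominus> a = d"
      using a d' by algebra
    then show ?thesis using d by simp
  qed
  then have "I +> (a \<oplus> d) = I +> a"
    using quotient_eq_iff_same_a_r_cos[OF I, of "a \<oplus> d" a] a d' by simp
  then have "I +> (a \<oplus> d) [^] n = I +> a [^] n"
    using a d' by (simp only: h.hom_pow a_closed)
  then have "(a \<oplus> d) [^] n \<ominus> a [^] n \<in> I"
    using quotient_eq_iff_same_a_r_cos[OF I] a d' by simp
  moreover have "(a \<oplus> d) [^] n = a [^] n \<oplus> ((a \<oplus> d) [^] n \<ominus> a [^] n)"
  proof -
    have "y = z \<oplus> (y \<ominus> z)" if "y \<in> carrier R" "z \<in> carrier R" for y z
      using that by algebra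
    then show ?thesis
      using a d' by simp
  qed
  ultimately show ?thesis
    by blast
qed


section \<open>Cartier maps compatible with a regular element\<close>

lemma (in monoid) nat_pow_pred_mult: "n > 0 \<Longrightarrow> a [^] (n - 1) \<otimes> a = a [^] n" for n :: nat
  by (cases n) simp_all

text \<open>\<open>\<psi>\<close> is \<open>x\<^sup>-\<^sup>1 \<phi> x\<close>: compatibility makes \<open>\<phi> (x r)\<close> divisible by \<open>x\<close>, and regularity makes the
  quotient unique, which is what makes \<open>\<psi>\<close> additive and \<open>p ^ (-e)\<close>-linear.\<close>

lemma p_inv_linear_divide_regular:
  fixes R :: "('a, 'b) ring_scheme" (structure)
  assumes R: "cring R" and x: "regular_element R x"
    and \<phi>: "p_inv_linear p e R \<phi>" and compat: "\<phi> ` (PIdl x) \<subseteq> PIdl x" and "p > 0"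
  obtains \<psi> where "p_inv_linear p e R \<psi>"
    and "\<And>r. r \<in> carrier R \<Longrightarrow> \<phi> r = \<psi> (x [^] (p ^ e - 1) \<otimes> r)"
proof -
  interpret cring R by (fact R)
  have x_carr: "x \<in> carrier R"
    using x by (simp add: regular_element_def)
  have cancel: "y = z" if "x \<otimes> y = x \<otimes> z" "y \<in> carrier R" "z \<in> carrier R" for y z
  proof -
    have "x \<otimes> (y \<ominus> z) = x \<otimes> y \<ominus> x \<otimes> z"
      using that(2,3) x_carr by algebra
    also have "\<dots> = \<zero>"
      using that x_carr by simp
    finally have "y \<ominus> z = \<zero>"
      using x that(2,3) by (simp add: regular_element_def)
    then show ?thesis
      using that by simp
  qed
  have "\<exists>y\<in>carrier R. \<phi> (x \<otimes> r) = x \<otimes> y" if r: "r \<in> carrier R" for r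
  proof -
    have "r \<otimes> x \<in> PIdl x"
      unfolding cgenideal_def using r by blast
    then have "\<phi> (r \<otimes> x) \<in> PIdl x"
      using compat by blast
    then obtain y where "y \<in> carrier R" "\<phi> (r \<otimes> x) = y \<otimes> x"
      unfolding cgenideal_def by blast
    then show ?thesis
      using r x_carr by (intro bexI[of _ y]) (simp_all add: m_comm)
  qed
  then obtain \<psi> where \<psi>_carr: "\<And>r. r \<in> carrier R \<Longrightarrow> \<psi> r \<in> carrier R"
    and \<psi>: "\<And>r. r \<in> carrier R \<Longrightarrow> \<phi> (x \<otimes> r) = x \<otimes> \<psi> r"
    by metis
  have "p_inv_linear p e R \<psi>"
  proof (rule p_inv_linearI)
    fix r s assume r: "r \<in> carrier R" and s: "s \<in> carrier R"
    show "\<psi> (r \<oplus> s) = \<psi> r \<oplus> \<psi> s"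
    proof (rule cancel)
      show "x \<otimes> \<psi> (r \<oplus> s) = x \<otimes> (\<psi> r \<oplus> \<psi> s)"
        using r s x_carr \<psi>_carr by (simp add: \<psi>[symmetric] r_distr p_inv_linear_add[OF \<phi>])
    qed (use r s \<psi>_carr in auto)
    show "\<psi> (r [^] (p ^ e) \<otimes> s) = r \<otimes> \<psi> s"
    proof (rule cancel)
      have "x \<otimes> \<psi> (r [^] (p ^ e) \<otimes> s) = \<phi> (r [^] (p ^ e) \<otimes> (x \<otimes> s))"
        using r s x_carr by (simp add: \<psi>[symmetric] m_lcomm)
      also have "\<dots> = r \<otimes> (x \<otimes> \<psi> s)"
        using r s x_carr by (simp add: p_inv_linear_smult[OF \<phi>] \<psi>)
      finally show "x \<otimes> \<psi> (r [^] (p ^ e) \<otimes> s) = x \<otimes> (r \<otimes> \<psi> s)"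
        using r s x_carr \<psi>_carr by (simp add: m_lcomm)
    qed (use r s \<psi>_carr in auto)
  qed (fact \<psi>_carr)
  moreover have "\<phi> r = \<psi> (x [^] (p ^ e - 1) \<otimes> r)" if r: "r \<in> carrier R" for r
  proof (rule cancel)
    have "x \<otimes> (x [^] (p ^ e - 1) \<otimes> r) = (x [^] (p ^ e - 1) \<otimes> x) \<otimes> r"
      using x_carr r by (simp only: m_ac nat_pow_closed m_closed)
    then have "x \<otimes> (x [^] (p ^ e - 1) \<otimes> r) = x [^] (p ^ e) \<otimes> r"
      using \<open>p > 0\<close> by (simp only: nat_pow_pred_mult zero_less_power)
    then show "x \<otimes> \<phi> r = x \<otimes> \<psi> (x [^] (p ^ e - 1) \<otimes> r)"
      using \<psi>[of "x [^] (p ^ e - 1) \<otimes> r"] p_inv_linear_smult[OF \<phi> x_carr r] x_carr r by simp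
  qed (use r x_carr \<psi>_carr p_inv_linear_closed[OF \<phi>] in auto)
  ultimately show thesis
    using that by blast
qed

text \<open>A converse to the division by a regular element: the factor
  \<open>y ^ (p ^ e - 1)\<close> completes an element of \<open>(y)\<close> to a multiple of \<open>y ^ (p ^ e)\<close>, from which \<open>\<psi>\<close>
  extracts a factor \<open>y\<close>. The scalar \<open>v\<close> normalises the value at \<open>\<one>\<close>.\<close>

lemma compatibly_F_pure_alongI:
  fixes R :: "('a, 'b) ring_scheme" (structure)
  assumes R: "prime_char_ring p R" and m: "ideal \<mm> R" and y: "y \<in> \<mm>"
    and \<psi>: "p_inv_linear p e R \<psi>" and "e \<ge> 1"
    and v: "v \<in> carrier R" "v \<otimes> \<psi> (y [^] (p ^ e - 1)) = \<one>"
  shows "compatibly_F_pure_along p R \<mm> (PIdl y)"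
proof -
  interpret cring R
    using R by (simp add: prime_char_ring_def)
  have "p > 0"
    using R by (simp add: prime_char_ring_def prime_gt_0_nat)
  have y_carr: "y \<in> carrier R"
    using ideal.Icarr[OF m y] .
  note \<psi>_carr = p_inv_linear_closed[OF \<psi>]
  let ?\<phi> = "\<lambda>r. v \<otimes> \<psi> (y [^] (p ^ e - 1) \<otimes> r)"
  have "p_inv_linear p e R ?\<phi>"
  proof (rule p_inv_linearI)
    fix r s assume r: "r \<in> carrier R" and s: "s \<in> carrier R"
    show "?\<phi> (r \<oplus> s) = ?\<phi> r \<oplus> ?\<phi> s"
      using r s v(1) y_carr \<psi>_carr by (simp add: r_distr p_inv_linear_add[OF \<psi>])
    show "?\<phi> (r [^] (p ^ e) \<otimes> s) = r \<otimes> ?\<phi> s"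
      using r s v(1) y_carr \<psi>_carr by (simp add: m_lcomm[of _ "r [^] (p ^ e)"] m_lcomm[of v r] p_inv_linear_smult[OF \<psi>])
  qed (use v(1) y_carr \<psi>_carr in auto)
  then have "cartier_map p R ?\<phi>"
    using \<open>e \<ge> 1\<close> by (auto simp: cartier_map_def)
  moreover have "?\<phi> \<one> = \<one>"
    using v y_carr by simp
  moreover have "?\<phi> ` (PIdl y) \<subseteq> PIdl y"
  proof (rule image_subsetI)
    fix a assume "a \<in> PIdl y"
    then obtain r where r: "r \<in> carrier R" "a = r \<otimes> y"
      by (auto simp: cgenideal_def)
    have "y [^] (p ^ e - 1) \<otimes> y = y [^] (p ^ e)"
      using \<open>p > 0\<close> by (intro nat_pow_pred_mult) simp
    then have "y [^] (p ^ e - 1) \<otimes> a = y [^] (p ^ e) \<otimes> r"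
      using r y_carr by (metis m_assoc m_comm nat_pow_closed)
    then have "?\<phi> a = v \<otimes> (y \<otimes> \<psi> r)"
      using r y_carr by (simp only: p_inv_linear_smult[OF \<psi>])
    then have "?\<phi> a = (v \<otimes> \<psi> r) \<otimes> y"
      using r v(1) y_carr \<psi>_carr by (simp add: m_ac)
    then show "?\<phi> a \<in> PIdl y"
      using r v(1) \<psi>_carr by (auto simp: cgenideal_def)
  qed
  moreover have "ideal (PIdl y) R" "PIdl y \<subseteq> \<mm>"
    using cgenideal_ideal[OF y_carr] cgenideal_minimal[OF m y] by auto
  ultimately show ?thesis
    using R unfolding compatibly_F_pure_along_def by blast
qed

text \<open>The preimage of \<open>I\<close> under \<open>\<psi>\<close> is in general only an additive subgroup, since \<open>\<psi>\<close> is linear over \<open>p ^ e\<close>-th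
  powers alone. Quantifying over all multiples gives the largest ideal that \<open>\<psi>\<close> maps into \<open>I\<close>.\<close>

lemma p_inv_linear_vimage_ideal:
  fixes R :: "('a, 'b) ring_scheme" (structure)
  assumes R: "cring R" and I: "ideal I R" and \<psi>: "p_inv_linear p e R \<psi>"
  shows "ideal {z \<in> carrier R. \<forall>r\<in>carrier R. \<psi> (r \<otimes> z) \<in> I} R"
proof -
  interpret cring R by (fact R)
  interpret I: ideal I R by (fact I)
  let ?J = "{z \<in> carrier R. \<forall>r\<in>carrier R. \<psi> (r \<otimes> z) \<in> I}"
  have "\<psi> \<zero> \<oplus> \<psi> \<zero> = \<psi> \<zero>"
    using p_inv_linear_add[OF \<psi>, of \<zero> \<zero>] by simp
  then have \<psi>_zero: "\<psi> \<zero> = \<zero>"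
    using p_inv_linear_closed[OF \<psi>, of \<zero>] by (metis add.r_cancel_one zero_closed)
  have mult: "z \<otimes> c \<in> ?J" if "z \<in> ?J" "c \<in> carrier R" for z c
  proof -
    have "r \<otimes> (z \<otimes> c) = (r \<otimes> c) \<otimes> z" if "r \<in> carrier R" for r
      using \<open>z \<in> ?J\<close> \<open>c \<in> carrier R\<close> that by (simp add: m_ac)
    then show ?thesis
      using that by auto
  qed
  show ?thesis
  proof (rule idealI[OF ring_axioms])
    show "subgroup ?J (add_monoid R)"
    proof (rule add.subgroupI)
      show "?J \<noteq> {}"
        using \<psi>_zero by auto
      show "\<ominus> z \<in> ?J" if "z \<in> ?J" for z
        using mult[OF that, of "\<ominus> \<one>"] that by (simp add: r_minus)
      show "z \<oplus> w \<in> ?J" if "z \<in> ?J" "w \<in> ?J" for z w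
        using that by (simp add: r_distr p_inv_linear_add[OF \<psi>])
    qed auto
    show "z \<otimes> c \<in> ?J" if "z \<in> ?J" "c \<in> carrier R" for z c
      using mult that by blast
    show "c \<otimes> z \<in> ?J" if "z \<in> ?J" "c \<in> carrier R" for z c
      using mult[OF that] that by (simp add: m_comm)
  qed
qed

text \<open>Continuity of Cartier maps for the \<open>I\<close>-adic topology. The largest ideal that \<open>\<psi>\<close> maps into \<open>I\<close>
  contains \<open>s ^ (p ^ e)\<close> for every \<open>s \<in> I\<close>, as \<open>\<psi> (r s ^ (p ^ e)) = s \<psi> r\<close>, so it contains a power of
  the finitely generated ideal \<open>I\<close>.\<close>

lemma p_inv_linear_ideal_power_subset:
  fixes R :: "('a, 'b) ring_scheme" (structure)
  assumes R: "cring R" "noetherian_ring R" and I: "ideal I R" and \<psi>: "p_inv_linear p e R \<psi>"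
  obtains N where "N > 0" and "\<psi> ` ideal_power R I N \<subseteq> I"
proof -
  interpret cring R by (fact R)
  interpret noetherian_ring R by (fact R)
  interpret I: ideal I R by (fact I)
  let ?J = "{z \<in> carrier R. \<forall>r\<in>carrier R. \<psi> (r \<otimes> z) \<in> I}"
  obtain S where S: "finite S" "S \<subseteq> carrier R" "I = Idl S"
    using finetely_gen[OF I] by blast
  have "s [^] (p ^ e) \<in> ?J" if s: "s \<in> S" for s
  proof -
    have s_I: "s \<in> I" and s_carr: "s \<in> carrier R"
      using s S genideal_self by auto
    have "\<psi> (r \<otimes> s [^] (p ^ e)) \<in> I" if r: "r \<in> carrier R" for r
    proof -
      have "\<psi> (r \<otimes> s [^] (p ^ e)) = s \<otimes> \<psi> r"
        using r s_carr p_inv_linear_smult[OF \<psi>, of s r] by (simp add: m_comm)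
      then show ?thesis
        using I.I_r_closed[OF s_I] p_inv_linear_closed[OF \<psi>] r by simp
    qed
    then show ?thesis
      using s_carr by simp
  qed
  then have "ideal_power R I (Suc (\<Sum>s\<in>S. p ^ e)) \<subseteq> ?J"
    unfolding S(3)
    using ideal_power_genideal_subset[OF S(1,2) p_inv_linear_vimage_ideal[OF R(1) I \<psi>], of "\<lambda>_. p ^ e"] S(3)
    by simp
  moreover have "\<psi> z \<in> I" if "z \<in> ?J" for z
    using that by (metis (mono_tags, lifting) l_one mem_Collect_eq one_closed)
  ultimately have "\<psi> ` ideal_power R I (Suc (\<Sum>s\<in>S. p ^ e)) \<subseteq> I"
    by blast
  then show thesis
    using that by blast
qed

lemma (in ring) ideal_power_subset:
  assumes "ideal I R" and "N > 0"
  shows "ideal_power R I N \<subseteq> I"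
proof -
  obtain n where "N = Suc n"
    using assms(2) gr0_implies_Suc by blast
  then show ?thesis
    using ideal_prod_inter[OF ideal_power_is_ideal[OF assms(1), of n] assms(1)]
    by (simp only: ideal_power_Suc le_inf_iff)
qed

theorem theorem5p15:
  fixes R :: "('a, 'b) ring_scheme" (structure) and \<mm> :: "'a set" and x :: 'a and p :: nat
  assumes "noetherian_local_ring R \<mm>"
    and "prime_char_ring p R"
    and "F_finite p R"
    and "x \<in> \<mm>"
    and "regular_element R x"
    and "compatibly_F_pure_along p R \<mm> (PIdl x)"
  shows "\<exists>N>0. \<forall>\<delta>\<in>ideal_power R \<mm> N.
           compatibly_F_pure_along p R \<mm> (PIdl (x \<oplus> \<delta>)) \<and>
           F_pure p (R Quot (PIdl (x \<oplus> \<delta>)))"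
proof -
  interpret cring R
    using assms(2) by (simp add: prime_char_ring_def)
  have noeth: "noetherian_ring R" and max: "maximalideal \<mm> R"
    using assms(1) by (auto simp: noetherian_local_ring_def)
  interpret \<mm>: maximalideal \<mm> R by (fact max)
  have m: "ideal \<mm> R" by (rule \<mm>.is_ideal)
  have "p > 0"
    using assms(2) by (simp add: prime_char_ring_def prime_gt_0_nat)
  have x_carr: "x \<in> carrier R"
    using assms(4) by (rule \<mm>.Icarr)
  obtain e \<phi> where e: "e \<ge> 1" and \<phi>: "p_inv_linear p e R \<phi>" "\<phi> \<one> = \<one>" "\<phi> ` (PIdl x) \<subseteq> PIdl x"
    using assms(6) by (auto simp: compatibly_F_pure_along_def cartier_map_def)
  obtain \<psi> where \<psi>: "p_inv_linear p e R \<psi>"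
    and \<phi>_eq: "\<And>r. r \<in> carrier R \<Longrightarrow> \<phi> r = \<psi> (x [^] (p ^ e - 1) \<otimes> r)"
    using p_inv_linear_divide_regular[OF is_cring assms(5) \<phi>(1,3) \<open>p > 0\<close>] by blast
  have \<psi>_x: "\<psi> (x [^] (p ^ e - 1)) = \<one>"
    using \<phi>_eq[of \<one>] \<phi>(2) x_carr by simp
  obtain N where N: "N > 0" and \<psi>_N: "\<psi> ` ideal_power R \<mm> N \<subseteq> \<mm>"
    using p_inv_linear_ideal_power_subset[OF is_cring noeth m \<psi>] by blast
  have "compatibly_F_pure_along p R \<mm> (PIdl (x \<oplus> \<delta>)) \<and> F_pure p (R Quot (PIdl (x \<oplus> \<delta>)))"
    if \<delta>: "\<delta> \<in> ideal_power R \<mm> N" for \<delta>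
  proof -
    let ?y = "x \<oplus> \<delta>"
    have power: "ideal (ideal_power R \<mm> N) R"
      by (rule ideal_power_is_ideal[OF m])
    have y: "?y \<in> \<mm>"
      using assms(4) \<delta> ideal_power_subset[OF m N] by blast
    obtain c where c: "c \<in> ideal_power R \<mm> N" "?y [^] (p ^ e - 1) = x [^] (p ^ e - 1) \<oplus> c"
      using pow_congruent[OF power x_carr \<delta>] by blast
    let ?u = "\<psi> (?y [^] (p ^ e - 1))"
    have \<psi>_c: "\<psi> c \<in> \<mm>"
      using \<psi>_N c(1) by blast
    have u: "?u = \<one> \<oplus> \<psi> c"
      using x_carr ideal.Icarr[OF power c(1)]
      by (simp only: c(2) p_inv_linear_add[OF \<psi>] \<psi>_x nat_pow_closed)
    have "?u \<notin> \<mm>"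
    proof
      assume "?u \<in> \<mm>"
      then have "?u \<ominus> \<psi> c \<in> \<mm>"
        using \<psi>_c by (simp add: a_minus_def)
      moreover have "?u \<ominus> \<psi> c = \<one>"
        using u \<mm>.Icarr[OF \<psi>_c] by (simp add: a_minus_def a_assoc r_neg)
      ultimately show False
        using \<mm>.one_imp_carrier \<mm>.I_notcarr by simp
    qed
    moreover have "?u \<in> carrier R"
      using u \<mm>.Icarr[OF \<psi>_c] by simp
    ultimately obtain v where v: "v \<in> carrier R" "v \<otimes> ?u = \<one>"
      using noetherian_local_ring_unit[OF assms(1)] by blast
    have pure: "compatibly_F_pure_along p R \<mm> (PIdl ?y)"
      by (rule compatibly_F_pure_alongI[OF assms(2) m y \<psi> e v])
    moreover have "PIdl ?y \<noteq> carrier R"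
      using cgenideal_minimal[OF m y] \<mm>.I_notcarr \<mm>.a_subset by blast
    ultimately show ?thesis
      using compatibly_F_pure_imp_F_pure_quotient by blast
  qed
  then show ?thesis
    using N by blast
qed

end
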